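(* For all complex numbers $z, w$ and every nonnegative integer $n$, $$(z+iw)^n=\frac{1}{2^n}\sum_{k=0}^n \binom{n}{k}\, i^k\, H_{n-k}(z)\, H_k(w).$$
   Context: $H_n$ denotes the $n$-th (physicists') Hermite polynomial, $H_n(z)=(-1)^n e^{z^2}\frac{d^n}{dz^n}e^{-z^2}$, equivalently determined by the generating function $e^{-t^2+2tz}=\sum_{n=0}^\infty H_n(z)\frac{t^n}{n!}$. Here $i$ is the imaginary unit. *)

theory Defs
  imports "HOL-Analysis.Analysis"
begin

text \<open>
  Physicists' Hermite polynomials as entire functions, by the Rodrigues formula. Since
  \<open>deriv\<close> is the complex derivative and \<open>exp (- (x ^ 2))\<close> is entire, all the iterated
  derivatives exist, so no default value of \<open>deriv\<close> is ever involved.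
\<close>

definition hermite :: "nat \<Rightarrow> complex \<Rightarrow> complex" where
  "hermite n z = (-1) ^ n * exp (z ^ 2) * (deriv ^^ n) (\<lambda>x. exp (- (x ^ 2))) z"

end

theory Submission
  imports Defs
begin

text \<open>
  The exponential generating function \<open>F\<close> of \<open>hermite n z\<close> satisfies \<open>F' = (2 z - 2 t) F\<close>
  (that is \<open>hermite_fps_ODE\<close>, which restates the three-term recurrence). Replacing \<open>z\<close> by \<open>w\<close>
  and \<open>t\<close> by \<open>\<i> t\<close> gives a series \<open>G\<close> with \<open>G' = (2 \<i> w + 2 t) G\<close>. In the equation for the
  product the terms in \<open>t\<close> cancel because \<open>\<i>\<^sup>2 = -1\<close>, leaving \<open>(F G)' = 2 (z + \<i> w) F G\<close>. So
  \<open>F G\<close> is the exponential series with parameter \<open>2 (z + \<i> w)\<close>, and the identity compares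
  coefficients: those of \<open>F G\<close> are the binomial convolution on the right-hand side.

  The recurrence comes from differentiating the Gaussian equation \<open>g' = -2 x g\<close> repeatedly.
\<close>

text \<open>
  This is Leibniz's rule for \<open>g' = -2 x g\<close>, in a form that also records that the iterated
  derivatives are differentiable, so that \<open>deriv\<close> may be evaluated.
\<close>

lemma gaussian_iterated_deriv:
  fixes z :: complex
  defines "g \<equiv> \<lambda>n. (deriv ^^ n) (\<lambda>x::complex. exp (- (x ^ 2)))"
  shows "(g n has_field_derivative (- 2 * z * g n z - 2 * of_nat n * g (n - 1) z)) (at z)"
proof (induction n arbitrary: z rule: less_induct)
  case (less n)
  have g_Suc: "g (Suc k) = deriv (g k)" for k
    by (simp add: g_def)
  show ?case
  proof (cases n)
    case 0
    then show ?thesis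
      unfolding g_def by (auto intro!: derivative_eq_intros)
  next
    case (Suc m)
    have D: "(g k has_field_derivative g (Suc k) x) (at x)" if "k \<le> m" for k x
      using less.IH[of k x] DERIV_imp_deriv[OF less.IH[of k x]] that Suc
      by (simp add: g_Suc)
    have g_n: "g n = (\<lambda>x. - 2 * x * g m x - 2 * of_nat m * g (m - 1) x)"
      using DERIV_imp_deriv[OF less.IH[of m]] Suc by (auto simp: g_Suc)
    \<comment> \<open>For \<open>m = 0\<close> the index \<open>m - 1\<close> truncates to \<open>0\<close>, but the coefficient vanishes.\<close>
    have shift: "of_nat m * g (Suc (m - 1)) z = of_nat m * g m z"
      by (cases m) auto
    have "((\<lambda>x. - 2 * x * g m x - 2 * of_nat m * g (m - 1) x) has_field_derivative
        (- 2 * g m z + - 2 * z * g n z - 2 * (of_nat m * g (Suc (m - 1)) z))) (at z)"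
      unfolding Suc
      by (rule derivative_eq_intros D[of m] D[of "m - 1"] refl | simp add: algebra_simps)+
    then show ?thesis
      unfolding shift g_n[symmetric] by (rule DERIV_cong) (simp add: Suc algebra_simps)
  qed
qed

lemma hermite_0: "hermite 0 z = 1"
  by (simp add: hermite_def flip: exp_add)

lemma hermite_Suc:
  "hermite (Suc n) z = 2 * z * hermite n z - 2 * of_nat n * hermite (n - 1) z"
proof -
  let ?g = "\<lambda>k. (deriv ^^ k) (\<lambda>x::complex. exp (- (x ^ 2)))"
  have "hermite (Suc n) z = - ((-1) ^ n * exp (z ^ 2) * deriv (?g n) z)"
    by (simp add: hermite_def)
  also have "\<dots> = - ((-1) ^ n * exp (z ^ 2) * (- 2 * z * ?g n z - 2 * of_nat n * ?g (n - 1) z))"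
    using DERIV_imp_deriv[OF gaussian_iterated_deriv[of n z]] by simp
  also have "\<dots> = 2 * z * hermite n z - 2 * of_nat n * hermite (n - 1) z"
    by (cases n) (simp_all add: hermite_def algebra_simps)
  finally show ?thesis .
qed

text \<open>
  The scaling parameter \<open>c\<close> serves to treat the substitution of \<open>\<i> t\<close> for \<open>t\<close> without composing
  power series.
\<close>

definition hermite_fps :: "complex \<Rightarrow> complex \<Rightarrow> complex fps" where
  "hermite_fps c z = Abs_fps (\<lambda>n. c ^ n * hermite n z / fact n)"

lemma hermite_fps_ODE:
  "fps_deriv (hermite_fps c z) = (fps_const (2 * c * z) - fps_const (2 * c\<^sup>2) * fps_X) * hermite_fps c z"
proof (rule fps_ext)
  fix n
  have "fps_nth (fps_deriv (hermite_fps c z)) n = c ^ Suc n * hermite (Suc n) z / fact n"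
    by (simp add: hermite_fps_def field_simps del: of_nat_Suc)
  also have "\<dots> = fps_nth ((fps_const (2 * c * z) - fps_const (2 * c\<^sup>2) * fps_X) * hermite_fps c z) n"
    by (cases n)
      (simp_all add: hermite_fps_def hermite_Suc left_diff_distrib mult.assoc field_simps
        power2_eq_square del: of_nat_Suc)
  finally show "fps_nth (fps_deriv (hermite_fps c z)) n = \<dots>" .
qed

lemma hermite_fps_mult:
  "hermite_fps 1 z * hermite_fps \<i> w = fps_exp (2 * (z + \<i> * w))"
proof -
  let ?P = "hermite_fps 1 z * hermite_fps \<i> w"
  \<comment> \<open>The coefficients \<open>2\<close> and \<open>- 2\<close> of \<open>fps_X\<close> are \<open>2 c\<^sup>2\<close> for \<open>c = 1\<close> and \<open>c = \<i>\<close>.\<close>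
  have "fps_deriv ?P =
      (fps_const (2 * z) + fps_const (2 * \<i> * w)
        - (fps_const 2 + fps_const (- 2)) * fps_X) * ?P"
    by (simp add: hermite_fps_ODE algebra_simps del: fps_const_add fps_const_sub fps_const_neg)
  then have "fps_deriv ?P = fps_const (2 * (z + \<i> * w)) * ?P"
    by (simp add: algebra_simps)
  moreover have "fps_nth ?P 0 = 1"
    by (simp add: hermite_fps_def hermite_0)
  ultimately show ?thesis
    by (metis fps_exp_unique_ODE fps_const_1_eq_1 mult_1)
qed

theorem mainTheorem1:
  fixes z w :: complex and n :: nat
  shows "(z + \<i> * w) ^ n =
    1 / 2 ^ n * (\<Sum>k=0..n. of_nat (n choose k) * \<i> ^ k * hermite (n - k) z * hermite k w)"
proof -
  have "(2 * (z + \<i> * w)) ^ n / fact n = fps_nth (hermite_fps \<i> w * hermite_fps 1 z) n"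
    by (simp add: hermite_fps_mult mult.commute[of "hermite_fps \<i> w"])
  also have "\<dots> = (\<Sum>k=0..n. (\<i> ^ k * hermite k w / fact k) * (hermite (n - k) z / fact (n - k)))"
    by (simp add: fps_mult_nth hermite_fps_def)
  also have "\<dots> =
      (\<Sum>k=0..n. of_nat (n choose k) * \<i> ^ k * hermite (n - k) z * hermite k w) / fact n"
    unfolding sum_divide_distrib
    by (intro sum.cong refl) (simp add: binomial_fact field_simps)
  finally show ?thesis
    by (simp only: power_mult_distrib) (simp add: field_simps)
qed

end
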